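(* Let $p\ge2$. There are exactly $2^{p-1}-1$ coatoms in the lattice $\mathbf{FS}$ of fine spectra of $p$-ary groupoids.
   Context: $p\ge 2$ is an integer. $T$ is the set of $p$-ary bracketings: terms (prefix notation) over the single variable $x$ and the $p$-ary operation symbol $\omega$, i.e. $x\in T$, and $\omega t_1\ldots t_p\in T$ whenever $t_1,\ldots,t_p\in T$. $|t|_\omega$ is the number of occurrences of $\omega$ in $t$; $\Lambda^{(p)}=\{(s,t)\in T\times T:|s|_\omega=|t|_\omega\}$. A $p$-ary groupoid is an algebra with one $p$-ary operation. $\varepsilon_1(t)$ is the term obtained from $t$ by replacing the occurrences of $x$, from left to right, by distinct variables $x_1,x_2,\ldots$. The fine spectrum $\sigma(\mathbf{A})$ of a $p$-ary groupoid $\mathbf{A}$ is the set of all $(s,t)\in\Lambda^{(p)}$ such that $\mathbf{A}$ satisfies the identity $\varepsilon_1(s)\approx\varepsilon_1(t)$. The set $FS$ of all fine spectra of $p$-ary groupoids, ordered by inclusion, is a complete lattice $\mathbf{FS}$. A coatom is an element covered by the greatest element. *)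

theory Defs
  imports Main "HOL-Library.Countable_Set"
begin

text \<open>Terms over a single operation symbol. The datatype leaves the arity open; \<open>trms p\<close>
  is the set of terms in which every application has exactly \<open>p\<close> arguments.\<close>

datatype 'v trm = Var 'v | Omega "'v trm list"

inductive_set trms :: "nat \<Rightarrow> 'v trm set" for p :: nat where
  Var: "Var v \<in> trms p"
| Omega: "length ts = p \<Longrightarrow> \<forall>t\<in>set ts. t \<in> trms p \<Longrightarrow> Omega ts \<in> trms p"

text \<open>A bracketing is a term over one variable, represented by the element of type \<open>unit\<close>.\<close>

type_synonym bracketing = "unit trm"

abbreviation bracketings :: "nat \<Rightarrow> bracketing set" where
  "bracketings p \<equiv> trms p"

fun omega_count :: "'v trm \<Rightarrow> nat" where
  "omega_count (Var v) = 0"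
| "omega_count (Omega ts) = Suc (sum_list (map omega_count ts))"

fun var_count :: "'v trm \<Rightarrow> nat" where
  "var_count (Var v) = 1"
| "var_count (Omega ts) = sum_list (map var_count ts)"

definition Lambda :: "nat \<Rightarrow> (bracketing \<times> bracketing) set" where
  "Lambda p = {(s, t). s \<in> bracketings p \<and> t \<in> bracketings p \<and> omega_count s = omega_count t}"

text \<open>\<open>number_vars k t\<close> replaces the variable occurrences of \<open>t\<close>, from left to right, by the
  variables with indices \<open>k\<close>, \<open>k + 1\<close>, and so on.\<close>

fun number_vars :: "nat \<Rightarrow> 'v trm \<Rightarrow> nat trm"
  and number_vars_list :: "nat \<Rightarrow> 'v trm list \<Rightarrow> nat trm list" where
  "number_vars k (Var v) = Var k"
| "number_vars k (Omega ts) = Omega (number_vars_list k ts)"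
| "number_vars_list k [] = []"
| "number_vars_list k (t # ts) = number_vars k t # number_vars_list (k + var_count t) ts"

definition \<epsilon>\<^sub>1 :: "bracketing \<Rightarrow> nat trm" where
  "\<epsilon>\<^sub>1 t = number_vars 1 t"

text \<open>A \<open>p\<close>-ary operation on \<open>A\<close> is a function on lists, of which only the values on lists of
  length \<open>p\<close> over \<open>A\<close> matter. As usual in universal algebra, carriers are nonempty.\<close>

definition groupoid :: "nat \<Rightarrow> 'a set \<Rightarrow> ('a list \<Rightarrow> 'a) \<Rightarrow> bool" where
  "groupoid p A f \<longleftrightarrow> A \<noteq> {} \<and> (\<forall>xs. length xs = p \<and> set xs \<subseteq> A \<longrightarrow> f xs \<in> A)"

fun eval_trm :: "('a list \<Rightarrow> 'a) \<Rightarrow> ('v \<Rightarrow> 'a) \<Rightarrow> 'v trm \<Rightarrow> 'a" where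
  "eval_trm f h (Var v) = h v"
| "eval_trm f h (Omega ts) = f (map (eval_trm f h) ts)"

definition satisfies :: "'a set \<Rightarrow> ('a list \<Rightarrow> 'a) \<Rightarrow> 'v trm \<Rightarrow> 'v trm \<Rightarrow> bool" where
  "satisfies A f l r \<longleftrightarrow> (\<forall>h. range h \<subseteq> A \<longrightarrow> eval_trm f h l = eval_trm f h r)"

definition fine_spectrum ::
  "nat \<Rightarrow> 'a set \<Rightarrow> ('a list \<Rightarrow> 'a) \<Rightarrow> (bracketing \<times> bracketing) set" where
  "fine_spectrum p A f = {(s, t) \<in> Lambda p. satisfies A f (\<epsilon>\<^sub>1 s) (\<epsilon>\<^sub>1 t)}"

text \<open>HOL cannot quantify over groupoids of all types at once, so the groupoids range over all
  nonempty subsets of a type \<open>'a\<close>. For infinite \<open>'a\<close> nothing is lost: by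
  \<open>fine_spectrum_in_fine_spectra\<close> below, this set then contains the fine spectrum of every
  groupoid, of any cardinality and over any type.\<close>

definition fine_spectra :: "nat \<Rightarrow> 'a itself \<Rightarrow> (bracketing \<times> bracketing) set set" where
  "fine_spectra p _ = {fine_spectrum p A f | (A :: 'a set) f. groupoid p A f}"

definition covered_in :: "'b::order set \<Rightarrow> 'b \<Rightarrow> 'b \<Rightarrow> bool" where
  "covered_in P x y \<longleftrightarrow> x \<in> P \<and> y \<in> P \<and> x < y \<and> (\<nexists>z. z \<in> P \<and> x < z \<and> z < y)"

definition coatoms :: "'b::order set \<Rightarrow> 'b set" where
  "coatoms P = {x. \<exists>g\<in>P. (\<forall>y\<in>P. y \<le> g) \<and> covered_in P x g}"

instance trm :: (countable) countable
  by countable_datatype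

lemma number_vars_in_trms:
  assumes "t \<in> trms p" shows "number_vars k t \<in> trms p"
  using assms
proof (induction arbitrary: k)
  case (Var v)
  then show ?case by (simp add: trms.Var)
next
  case (Omega ts)
  have "length (number_vars_list k us) = length us \<and>
        (\<forall>u\<in>set (number_vars_list k us). u \<in> trms p)"
    if "set us \<subseteq> set ts" for us k
    using that by (induction us arbitrary: k) (use Omega in auto)
  then show ?case using Omega.hyps by (auto intro: trms.Omega)
qed

lemma eval_trm_closed:
  assumes "t \<in> trms p" "groupoid p A f" "range h \<subseteq> A"
  shows "eval_trm f h t \<in> A"
  using assms
proof induction
  case (Omega ts)
  then have "length (map (eval_trm f h) ts) = p" "set (map (eval_trm f h) ts) \<subseteq> A" by auto
  then show ?case using Omega.prems(1) unfolding groupoid_def eval_trm.simps by blast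
qed auto

lemma eval_trm_transport:
  assumes t: "t \<in> trms p" and A: "groupoid p A f" and h: "range h \<subseteq> A"
    and inj: "inj_on \<phi> A"
  shows "eval_trm (\<lambda>xs. \<phi> (f (map (inv_into A \<phi>) xs))) (\<phi> \<circ> h) t = \<phi> (eval_trm f h t)"
  using t
proof induction
  case (Omega ts)
  let ?g = "\<lambda>xs. \<phi> (f (map (inv_into A \<phi>) xs))"
  have "inv_into A \<phi> (eval_trm ?g (\<phi> \<circ> h) u) = eval_trm f h u" if "u \<in> set ts" for u
  proof -
    have "u \<in> trms p" and *: "eval_trm ?g (\<phi> \<circ> h) u = \<phi> (eval_trm f h u)"
      using Omega that by blast+
    then have "eval_trm f h u \<in> A" by (intro eval_trm_closed[OF _ A h])
    then show ?thesis unfolding * by (rule inv_into_f_f[OF inj])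
  qed
  then have "map (inv_into A \<phi>) (map (eval_trm ?g (\<phi> \<circ> h)) ts) = map (eval_trm f h) ts"
    unfolding map_map by (intro map_cong) (simp_all only: o_apply)
  then show ?case by (simp only: eval_trm.simps)
qed auto

lemma fine_spectrum_transport:
  assumes A: "groupoid p A f" and inj: "inj_on \<phi> A"
  defines "g \<equiv> \<lambda>xs. \<phi> (f (map (inv_into A \<phi>) xs))"
  shows "groupoid p (\<phi> ` A) g" "fine_spectrum p (\<phi> ` A) g = fine_spectrum p A f"
proof -
  have inv: "inv_into A \<phi> x \<in> A" if "x \<in> \<phi> ` A" for x
    using that by (rule inv_into_into)
  show "groupoid p (\<phi> ` A) g"
    unfolding groupoid_def
  proof (intro conjI allI impI)
    show "\<phi> ` A \<noteq> {}" using A by (simp add: groupoid_def)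
    fix xs assume xs: "length xs = p \<and> set xs \<subseteq> \<phi> ` A"
    then have "length (map (inv_into A \<phi>) xs) = p" "set (map (inv_into A \<phi>) xs) \<subseteq> A"
      using inv by auto
    then show "g xs \<in> \<phi> ` A" using A unfolding groupoid_def g_def by blast
  qed
  have "satisfies (\<phi> ` A) g l r \<longleftrightarrow> satisfies A f l r"
    if l: "l \<in> trms p" and r: "r \<in> trms p" for l r :: "nat trm"
  proof
    assume S: "satisfies (\<phi> ` A) g l r"
    show "satisfies A f l r"
      unfolding satisfies_def
    proof (intro allI impI)
      fix h :: "nat \<Rightarrow> 'a" assume h: "range h \<subseteq> A"
      then have "range (\<phi> \<circ> h) \<subseteq> \<phi> ` A" by auto
      then have "eval_trm g (\<phi> \<circ> h) l = eval_trm g (\<phi> \<circ> h) r"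
        using S unfolding satisfies_def by blast
      then have "\<phi> (eval_trm f h l) = \<phi> (eval_trm f h r)"
        using eval_trm_transport[OF l A h inj] eval_trm_transport[OF r A h inj]
        by (simp add: g_def)
      then show "eval_trm f h l = eval_trm f h r"
        using inj eval_trm_closed[OF l A h] eval_trm_closed[OF r A h] by (simp add: inj_on_eq_iff)
    qed
  next
    assume S: "satisfies A f l r"
    show "satisfies (\<phi> ` A) g l r"
      unfolding satisfies_def
    proof (intro allI impI)
      fix k :: "nat \<Rightarrow> 'b" assume k: "range k \<subseteq> \<phi> ` A"
      define h where "h = inv_into A \<phi> \<circ> k"
      have h: "range h \<subseteq> A" using k inv unfolding h_def by auto
      have "\<phi> (inv_into A \<phi> (k n)) = k n" for n
        using k by (intro f_inv_into_f) auto
      then have kh: "k = \<phi> \<circ> h" unfolding h_def by auto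
      have "eval_trm f h l = eval_trm f h r" using S h unfolding satisfies_def by blast
      then show "eval_trm g k l = eval_trm g k r"
        using eval_trm_transport[OF l A h inj] eval_trm_transport[OF r A h inj]
        by (simp add: g_def kh)
    qed
  qed
  then show "fine_spectrum p (\<phi> ` A) g = fine_spectrum p A f"
    unfolding fine_spectrum_def Lambda_def \<epsilon>\<^sub>1_def by (auto simp: number_vars_in_trms)
qed

lemma countable_subgroupoid:
  fixes B :: "'b set"
  assumes B: "groupoid p B g"
  obtains C where "countable C" "groupoid p C g" "fine_spectrum p C g = fine_spectrum p B g"
proof -
  obtain b where b: "b \<in> B" using B unfolding groupoid_def by blast
  define F :: "(nat trm \<times> nat trm) set" where "F = {(l, r). \<not> satisfies B g l r}"
  have "\<forall>q\<in>F. \<exists>h. range h \<subseteq> B \<and> eval_trm g h (fst q) \<noteq> eval_trm g h (snd q)"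
    unfolding F_def satisfies_def by auto
  from bchoice[OF this] obtain H where H: "\<And>q. q \<in> F \<Longrightarrow> range (H q) \<subseteq> B"
    "\<And>q. q \<in> F \<Longrightarrow> eval_trm g (H q) (fst q) \<noteq> eval_trm g (H q) (snd q)"
    by blast
  define W where "W = insert b (\<Union>q\<in>F. range (H q))"
  have W: "countable W" "W \<noteq> {}" "W \<subseteq> B" unfolding W_def using H(1) b by auto
  define e where "e = from_nat_into W"
  have e: "range e = W" unfolding e_def using W by (simp add: range_from_nat_into)
  define C where "C = eval_trm g e ` trms p"
  have WC: "W \<subseteq> C"
  proof
    fix w assume "w \<in> W"
    then have "w \<in> range e" by (simp only: e)
    then obtain n where "w = e n" by (rule imageE)
    then have "w = eval_trm g e (Var n)" by (simp only: eval_trm.simps)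
    then show "w \<in> C" unfolding C_def by (rule image_eqI) (rule trms.Var)
  qed
  have CB: "C \<subseteq> B" unfolding C_def using eval_trm_closed[OF _ B] e W(3) by auto
  have "countable C" unfolding C_def by simp
  moreover have "groupoid p C g"
    unfolding groupoid_def
  proof (intro conjI allI impI)
    show "C \<noteq> {}" using WC W(2) by blast
    fix xs assume xs: "length xs = p \<and> set xs \<subseteq> C"
    then have "\<forall>x\<in>set xs. \<exists>t. t \<in> trms p \<and> x = eval_trm g e t" unfolding C_def by auto
    from bchoice[OF this] obtain T where
      T: "\<And>x. x \<in> set xs \<Longrightarrow> T x \<in> trms p \<and> x = eval_trm g e (T x)" by blast
    have "map (eval_trm g e) (map T xs) = xs" using T by (simp add: map_idI)
    then have "g xs = eval_trm g e (Omega (map T xs))" by simp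
    moreover have "Omega (map T xs) \<in> trms p" using T xs by (intro trms.Omega) auto
    ultimately show "g xs \<in> C" unfolding C_def by blast
  qed
  moreover have "satisfies C g l r \<longleftrightarrow> satisfies B g l r" for l r :: "nat trm"
  proof
    assume "satisfies B g l r"
    then show "satisfies C g l r" using CB unfolding satisfies_def by blast
  next
    assume S: "satisfies C g l r"
    show "satisfies B g l r"
    proof (rule ccontr)
      assume "\<not> satisfies B g l r"
      then have q: "(l, r) \<in> F" unfolding F_def by simp
      then have "range (H (l, r)) \<subseteq> C" using WC unfolding W_def by blast
      then show False using S H(2)[OF q] unfolding satisfies_def by auto
    qed
  qed
  then have "fine_spectrum p C g = fine_spectrum p B g"
    unfolding fine_spectrum_def by auto
  ultimately show thesis using that by blast
qed

theorem fine_spectrum_in_fine_spectra: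
  fixes B :: "'b set"
  assumes inf: "infinite (UNIV :: 'a set)" and B: "groupoid p B g"
  shows "fine_spectrum p B g \<in> fine_spectra p TYPE('a)"
proof -
  obtain C where C: "countable C" "groupoid p C g" "fine_spectrum p C g = fine_spectrum p B g"
    using countable_subgroupoid[OF B] .
  obtain \<psi> :: "nat \<Rightarrow> 'a" where "inj \<psi>" using infinite_countable_subset[OF inf] by blast
  then have "inj_on (\<psi> \<circ> to_nat_on C) C"
    using C(1) by (intro comp_inj_on inj_on_to_nat_on) (auto intro: inj_on_subset)
  from fine_spectrum_transport[OF C(2) this] C(3) show ?thesis
    unfolding fine_spectra_def by blast
qed

end

theory Submission
  imports Defs
begin

text \<open>There is one bracketing with no \<open>\<omega>\<close>, one with a single \<open>\<omega>\<close>, and there are \<open>p\<close> with two,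
  determined by the position of the inner \<open>\<omega>\<close>. If a fine spectrum identifies these \<open>p\<close>
  bracketings, the operation is associative and, by generalized associativity, the spectrum is
  all of \<open>\<Lambda>\<close>. Conversely, any equivalence relation on the \<open>p\<close> bracketings can be prescribed while
  identifying all longer bracketings of equal size, since a groupoid may send every
  longer product to a zero element. So the coatoms correspond to the partitions of the \<open>p\<close> positions
  into two nonempty blocks.\<close>

section \<open>Bracketings with two operation symbols\<close>

definition nested :: "nat \<Rightarrow> nat \<Rightarrow> bracketing" where
  "nested p i =
    Omega (replicate i (Var ()) @ Omega (replicate p (Var ())) # replicate (p - Suc i) (Var ()))"

lemma trms_OmegaD: "Omega ts \<in> trms p \<Longrightarrow> length ts = p \<and> set ts \<subseteq> trms p"
  by (auto elim: trms.cases)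

lemma omega_count_replicate_Var [simp]: "sum_list (map omega_count (replicate n (Var v))) = 0"
  by (induction n) auto

lemma omega_count_nested [simp]: "omega_count (nested p i) = 2"
  unfolding nested_def by (simp del: map_replicate)

lemma nested_in_trms: "i < p \<Longrightarrow> nested p i \<in> trms p"
  unfolding nested_def by (intro trms.Omega) (auto intro!: trms.intros)

lemma nested_in_Lambda: "i < p \<Longrightarrow> j < p \<Longrightarrow> (nested p i, nested p j) \<in> Lambda p"
  by (simp add: Lambda_def nested_in_trms)

lemma replicate_Cons_eq_iff:
  assumes "x \<noteq> y"
  shows "replicate i x @ y # us = replicate j x @ y # vs \<longleftrightarrow> i = j \<and> us = vs"
proof
  assume eq: "replicate i x @ y # us = replicate j x @ y # vs"
  \<comment> \<open>The length of the initial run of \<open>x\<close> recovers the position of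
    \<open>y\<close>.\<close>
  have "length (takeWhile ((=) x) (replicate k x @ y # ws)) = k" for k ws
    using assms by (induction k) auto
  then have "i = j" using eq by metis
  with eq show "i = j \<and> us = vs" by simp
qed simp

lemma nested_inject: "nested p i = nested p j \<longleftrightarrow> i = j"
  by (auto simp: nested_def replicate_Cons_eq_iff)

lemma trm_omega_count_0: "omega_count t = 0 \<Longrightarrow> (t :: bracketing) = Var ()"
  by (cases t) auto

lemma trm_omega_count_1:
  assumes "t \<in> bracketings p" "omega_count t = 1"
  shows "t = Omega (replicate p (Var ()))"
proof (cases t)
  case (Omega ts)
  then have "length ts = p" "\<forall>u\<in>set ts. u = Var ()"
    using assms by (auto dest!: trms_OmegaD intro: trm_omega_count_0)
  then have "ts = replicate p (Var ())" by (intro replicate_eqI) auto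
  then show ?thesis using Omega by simp
qed (use assms in simp)

text \<open>A sum of naturals equal to 1 has exactly one nonzero term. With
  \<open>omega_count\<close> this locates the single argument that carries the inner operation
  symbol.\<close>

lemma sum_list_map_eq_1:
  fixes g :: "'b \<Rightarrow> nat"
  assumes "sum_list (map g ts) = 1"
  obtains us u ws where "ts = us @ u # ws" "g u = 1" "\<forall>x\<in>set us \<union> set ws. g x = 0"
  using assms
proof (induction ts arbitrary: thesis)
  case (Cons a ts)
  show ?case
  proof (cases "g a = 0")
    case True
    then have "sum_list (map g ts) = 1" using Cons.prems(2) by simp
    then obtain us u ws where "ts = us @ u # ws" "g u = 1" "\<forall>x\<in>set us \<union> set ws. g x = 0"
      using Cons.IH by blast
    then show ?thesis using True by (intro Cons.prems(1)[of "a # us" u ws]) auto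
  next
    case False
    moreover have "g a + sum_list (map g ts) = 1" using Cons.prems(2) by simp
    ultimately have "g a = 1" "sum_list (map g ts) = 0" by linarith+
    then have "g a = 1" "\<forall>x\<in>set ts. g x = 0" by auto
    then show ?thesis by (intro Cons.prems(1)[of "[]" a ts]) auto
  qed
qed simp

lemma trm_omega_count_2:
  assumes "t \<in> bracketings p" "omega_count t = 2"
  obtains i where "i < p" "t = nested p i"
proof (cases t)
  case (Omega ts)
  then have ts: "length ts = p" "set ts \<subseteq> trms p" "sum_list (map omega_count ts) = 1"
    using assms by (auto dest!: trms_OmegaD)
  obtain us u ws where split: "ts = us @ u # ws" and u: "omega_count u = 1"
    and "\<forall>x\<in>set us \<union> set ws. omega_count x = 0"
    using sum_list_map_eq_1[OF ts(3)] .
  then have vars: "\<forall>x\<in>set us. x = Var ()" "\<forall>x\<in>set ws. x = Var ()"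
    by (auto intro: trm_omega_count_0)
  then have "us = replicate (length us) (Var ())"
    by (intro replicate_eqI) auto
  moreover have "ws = replicate (p - Suc (length us)) (Var ())"
    using vars ts(1) split by (intro replicate_eqI) auto
  moreover have "u = Omega (replicate p (Var ()))"
    using u ts split by (intro trm_omega_count_1) auto
  ultimately have "t = nested p (length us)"
    using Omega split unfolding nested_def by metis
  moreover have "length us < p" using ts(1) split by simp
  ultimately show thesis using that by blast
qed (use assms in simp)

section \<open>Generalized associativity\<close>

lemma sum_list_var_count:
  assumes "\<And>t. t \<in> set ts \<Longrightarrow> var_count t = Suc (omega_count t * (p - 1))"
  shows "sum_list (map var_count ts) = sum_list (map omega_count ts) * (p - 1) + length ts"
  using assms by (induction ts) (auto simp: algebra_simps)

text \<open>Each operation symbol turns one leaf into \<open>p\<close> leaves, a gain of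
  \<open>p - 1\<close>. Hence bracketings of equal size have equally many variables.\<close>

lemma var_count_eq:
  assumes "t \<in> trms p" "p > 0"
  shows "var_count t = Suc (omega_count t * (p - 1))"
  using assms
proof induction
  case (Omega ts)
  then show ?case by (subst var_count.simps, subst sum_list_var_count[of _ p]) auto
qed simp

text \<open>The left-normed product of a word: the first \<open>p\<close> letters are multiplied
  until fewer than \<open>p\<close> remain. For \<open>p \<ge> 2\<close>, exactly one letter remains
  if the length of a nonempty word is 1 modulo \<open>p - 1\<close>. The guard \<open>p < 2\<close>
  covers the cases where a step need not shorten the word.\<close>

function reduce :: "nat \<Rightarrow> ('a list \<Rightarrow> 'a) \<Rightarrow> 'a list \<Rightarrow> 'a" where
  "reduce p f xs =
    (if p < 2 \<or> length xs < p then hd xs else reduce p f (f (take p xs) # drop p xs))"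
  by pat_completeness auto
termination by (relation "measure (\<lambda>(p, f, xs). length xs)") auto

declare reduce.simps [simp del]

lemma reduce_singleton: "p \<ge> 2 \<Longrightarrow> reduce p f [x] = x"
  by (subst reduce.simps) simp

lemma reduce_append:
  "p \<ge> 2 \<Longrightarrow> length xs = p \<Longrightarrow> reduce p f (xs @ ys) = reduce p f (f xs # ys)"
  by (subst reduce.simps) auto

text \<open>On words of length \<open>2 * p - 1\<close>, an inner product starting after
  \<open>us\<close> is compared with the one starting at the first letter.\<close>

definition associative_on :: "nat \<Rightarrow> 'a set \<Rightarrow> ('a list \<Rightarrow> 'a) \<Rightarrow> bool" where
  "associative_on p A f \<longleftrightarrow> (\<forall>us vs ws. set (us @ vs @ ws) \<subseteq> A \<longrightarrow> length vs = p \<longrightarrow>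
    Suc (length us + length ws) = p \<longrightarrow>
    f (us @ f vs # ws) = f (f (take p (us @ vs)) # drop p (us @ vs) @ ws))"

text \<open>Induction on the prefix. A prefix of at least \<open>p\<close> letters loses its first
  \<open>p\<close> letters to the same product on both sides. For a shorter nonempty prefix, two
  reduction steps on the left yield a left-nested product, and associativity moves its inner product
  onto \<open>ws\<close>.\<close>

lemma reduce_inner:
  assumes p: "p \<ge> 2" and f: "groupoid p A f" and assoc: "associative_on p A f"
    and "length ws = p" "p - 1 dvd length xs + length zs" "set (xs @ ws @ zs) \<subseteq> A"
  shows "reduce p f (xs @ ws @ zs) = reduce p f (xs @ f ws # zs)"
  using assms(4-)
proof (induction xs rule: length_induct)
  case (1 xs)
  consider "xs = []" | "xs \<noteq> []" "length xs < p" | "length xs \<ge> p" by fastforce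
  then show ?case
  proof cases
    case 1
    then show ?thesis using reduce_append[OF p] "1.prems" by simp
  next
    case 2
    \<comment> \<open>A positive multiple of \<open>p - 1\<close> is at least \<open>p - 1\<close>,
      so \<open>zs\<close> has enough letters to fill the outer product around
      \<open>f ws\<close>.\<close>
    then have "p - 1 \<le> length xs + length zs" using "1.prems"(2) by (intro dvd_imp_le) auto
    then obtain zs1 zs2 where zs: "zs = zs1 @ zs2" "Suc (length xs + length zs1) = p"
      using 2 by (intro that[of "take (p - Suc (length xs)) zs" "drop (p - Suc (length xs)) zs"]) auto
    let ?l = "take p (xs @ ws)" and ?r = "drop p (xs @ ws)"
    have "reduce p f (xs @ ws @ zs) = reduce p f (?l @ (?r @ zs))"
      by (metis append.assoc append_take_drop_id)
    also have "\<dots> = reduce p f (f ?l # ?r @ zs)"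
      using "1.prems" by (intro reduce_append p) simp
    also have "\<dots> = reduce p f ((f ?l # ?r @ zs1) @ zs2)" using zs by simp
    also have "\<dots> = reduce p f (f (f ?l # ?r @ zs1) # zs2)"
      using "1.prems" zs 2 by (intro reduce_append p) auto
    also have "f (f ?l # ?r @ zs1) = f (xs @ f ws # zs1)"
      using assoc "1.prems" zs unfolding associative_on_def by auto
    also have "reduce p f (f (xs @ f ws # zs1) # zs2) = reduce p f ((xs @ f ws # zs1) @ zs2)"
      using zs by (intro reduce_append[symmetric] p) auto
    finally show ?thesis using zs by simp
  next
    case 3
    then obtain xs1 xs2 where xs: "xs = xs1 @ xs2" "length xs1 = p"
      by (intro that[of "take p xs" "drop p xs"]) auto
    have "f xs1 \<in> A" using f xs "1.prems" unfolding groupoid_def by auto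
    \<comment> \<open>Contracting \<open>p\<close> letters to one shortens the word by
      \<open>p - 1\<close>, which preserves the divisibility.\<close>
    moreover have "length xs + length zs = (p - 1) + (length (f xs1 # xs2) + length zs)"
      using xs p by simp
    then have "p - 1 dvd length (f xs1 # xs2) + length zs"
      using "1.prems"(2) by (metis dvd_add_triv_left_iff)
    moreover have "length (f xs1 # xs2) < length xs" using xs p by simp
    ultimately have "reduce p f ((f xs1 # xs2) @ ws @ zs) = reduce p f ((f xs1 # xs2) @ f ws # zs)"
      using "1.prems" xs by (intro "1.IH"[rule_format]) auto
    then show ?thesis using xs reduce_append[OF p xs(2)] by simp
  qed
qed

lemma map_upt_add: "map h [k..<k + (m + n)] = map h [k..<k + m] @ map h [k + m..<(k + m) + n]"
  by (metis add.assoc le_add1 map_append upt_add_eq_append)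

text \<open>Induction on the term collapses the block of letters below each subterm to its value.
  The context \<open>xs\<close>, \<open>zs\<close> is arbitrary because subterms sit inside larger
  words; with empty context, the value of the term is the left-normed product of its
  variables.\<close>

lemma reduce_number_vars:
  assumes p: "p \<ge> 2" and f: "groupoid p A f" and assoc: "associative_on p A f"
    and h: "range h \<subseteq> A" and "t \<in> trms p"
    and "p - 1 dvd length xs + length zs" "set (xs @ zs) \<subseteq> A"
  shows "reduce p f (xs @ map h [k..<k + var_count t] @ zs)
    = reduce p f (xs @ eval_trm f h (number_vars k t) # zs)"
  using assms(5-)
proof (induction arbitrary: xs zs k)
  case (Omega ts)
  have closed: "eval_trm f h (number_vars k t) \<in> A" if "t \<in> trms p" for k and t :: "'b trm"
    using eval_trm_closed[OF number_vars_in_trms[OF that] f h] .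
  \<comment> \<open>The arguments are evaluated from left to right, and finished values join
    \<open>xs\<close>. This leaves the length in the divisibility condition unchanged; its
    \<open>- 1\<close> accounts for the argument currently being evaluated.\<close>
  have list: "reduce p f (xs @ map h [k..<k + sum_list (map var_count us)] @ zs)
      = reduce p f (xs @ map (eval_trm f h) (number_vars_list k us) @ zs)
      \<and> length (number_vars_list k us) = length us
      \<and> set (map (eval_trm f h) (number_vars_list k us)) \<subseteq> A"
    if "set us \<subseteq> set ts" "p - 1 dvd length xs + length us + length zs - 1" "set (xs @ zs) \<subseteq> A"
    for us xs zs k
    using that
  proof (induction us arbitrary: xs k)
    case (Cons u us)
    let ?v = "map h [k + var_count u..<(k + var_count u) + sum_list (map var_count us)]"
    let ?e = "eval_trm f h (number_vars k u)"
    have u: "u \<in> set ts" "u \<in> trms p" using Cons.prems(1) Omega.IH by auto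
    \<comment> \<open>Arguments not yet evaluated are still words, but their total length agrees
      with their number modulo \<open>p - 1\<close>.\<close>
    have us: "sum_list (map var_count us) = sum_list (map omega_count us) * (p - 1) + length us"
      using Cons.prems(1) Omega.IH p by (intro sum_list_var_count var_count_eq) auto
    have "p - 1 dvd (length xs + length us + length zs) + sum_list (map omega_count us) * (p - 1)"
      using Cons.prems(2) by (intro dvd_add[OF _ dvd_triv_right]) simp
    then have dvd: "p - 1 dvd length xs + length (?v @ zs)" by (simp add: us algebra_simps)
    have "reduce p f (xs @ map h [k..<k + var_count u] @ (?v @ zs)) = reduce p f (xs @ ?e # (?v @ zs))"
    proof -
      have "reduce p f (xs @ map h [k..<k + var_count u] @ zs)
          = reduce p f (xs @ eval_trm f h (number_vars k u) # zs)"
        if "p - 1 dvd length xs + length zs" "set (xs @ zs) \<subseteq> A" for xs zs k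
        using Omega.IH u(1) that by blast
      from this[OF dvd] show ?thesis using Cons.prems(3) h by auto
    qed
    moreover have "p - 1 dvd length (xs @ [?e]) + length us + length zs - 1"
      using Cons.prems(2) by simp
    with Cons.IH[of "xs @ [?e]" "k + var_count u"] Cons.prems closed[OF u(2)]
    have "reduce p f ((xs @ [?e]) @ ?v @ zs)
        = reduce p f ((xs @ [?e]) @ map (eval_trm f h) (number_vars_list (k + var_count u) us) @ zs)
        \<and> length (number_vars_list (k + var_count u) us) = length us
        \<and> set (map (eval_trm f h) (number_vars_list (k + var_count u) us)) \<subseteq> A"
      by auto
    ultimately show ?case using closed[OF u(2)] by (simp add: map_upt_add del: map_map)
  qed simp
  let ?ws = "map (eval_trm f h) (number_vars_list k ts)"
  have "p - 1 dvd (p - 1) + (length xs + length zs)"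
    using Omega.prems(1) by (intro dvd_add[OF dvd_refl])
  moreover have "(p - 1) + (length xs + length zs) = length xs + length ts + length zs - 1"
    using p Omega.hyps by simp
  ultimately have "p - 1 dvd length xs + length ts + length zs - 1" by metis
  from list[OF subset_refl this Omega.prems(2)]
  have "reduce p f (xs @ map h [k..<k + var_count (Omega ts)] @ zs) = reduce p f (xs @ ?ws @ zs)"
    and "length ?ws = p" "set ?ws \<subseteq> A"
    using Omega.hyps by auto
  \<comment> \<open>With all arguments evaluated, the outermost application is itself an inner
    product of the word.\<close>
  moreover from this have "reduce p f (xs @ ?ws @ zs) = reduce p f (xs @ f ?ws # zs)"
    using Omega.prems by (intro reduce_inner[OF p f assoc]) auto
  ultimately show ?case by simp
qed simp

text \<open>Both sides equal the left-normed product of the same word, whose length depends only on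
  the number of operation symbols.\<close>

lemma associative_on_imp_satisfies:
  assumes "p \<ge> 2" "groupoid p A f" "associative_on p A f" "(s, t) \<in> Lambda p"
  shows "satisfies A f (\<epsilon>\<^sub>1 s) (\<epsilon>\<^sub>1 t)"
  unfolding satisfies_def \<epsilon>\<^sub>1_def
proof (intro allI impI)
  fix h :: "nat \<Rightarrow> 'a" assume h: "range h \<subseteq> A"
  have st: "s \<in> trms p" "t \<in> trms p" "omega_count s = omega_count t"
    using assms(4) by (auto simp: Lambda_def)
  have "eval_trm f h (number_vars 1 u) = reduce p f (map h [1..<1 + var_count u])"
    if "u \<in> trms p" for u :: bracketing
    using reduce_number_vars[OF assms(1-3) h that, of "[]" "[]" 1] assms(1)
    by (simp add: reduce_singleton)
  moreover have "var_count s = var_count t" using st assms(1) by (simp add: var_count_eq)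
  ultimately show "eval_trm f h (number_vars 1 s) = eval_trm f h (number_vars 1 t)"
    using st by simp
qed

section \<open>From identities between bracketings with two operation symbols to
  associativity\<close>

lemma number_vars_list_replicate:
  "number_vars_list k (replicate n (Var v) @ ts) = map Var [k..<k + n] @ number_vars_list (k + n) ts"
  by (induction n arbitrary: k) (auto simp: upt_conv_Cons)

lemma map_nth_upt:
  assumes "h = (\<lambda>n. if n - 1 < length xs then xs ! (n - 1) else a)" "i + n \<le> length xs"
  shows "map h [Suc i..<Suc i + n] = take n (drop i xs)"
  using assms(2) by (intro nth_equalityI) (auto simp: assms(1) nth_append simp del: upt_Suc)

lemma eval_nested:
  assumes "i < p" "h = (\<lambda>n. if n - 1 < length xs then xs ! (n - 1) else a)"
    "length xs = 2 * p - 1"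
  shows "eval_trm f h (\<epsilon>\<^sub>1 (nested p i)) = f (take i xs @ f (take p (drop i xs)) # drop (i + p) xs)"
proof -
  have "number_vars 1 (nested p i) = Omega (map Var [Suc 0..<Suc 0 + i] @
      Omega (map Var [Suc i..<Suc i + p]) # map Var [Suc (i + p)..<Suc (i + p) + (p - Suc i)])"
    using number_vars_list_replicate[of _ _ "()" "[]"]
    by (simp add: nested_def number_vars_list_replicate sum_list_replicate del: upt_Suc)
  then have "eval_trm f h (\<epsilon>\<^sub>1 (nested p i)) = f (map h [Suc 0..<Suc 0 + i] @
      f (map h [Suc i..<Suc i + p]) # map h [Suc (i + p)..<Suc (i + p) + (p - Suc i)])"
    unfolding \<epsilon>\<^sub>1_def by (simp add: comp_def del: upt_Suc)
  also have "map h [Suc 0..<Suc 0 + i] = take i xs"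
    using map_nth_upt[OF assms(2), of 0 i] assms by simp
  also have "map h [Suc i..<Suc i + p] = take p (drop i xs)"
    using map_nth_upt[OF assms(2), of i p] assms by simp
  also have "map h [Suc (i + p)..<Suc (i + p) + (p - Suc i)] = drop (i + p) xs"
    using map_nth_upt[OF assms(2), of "i + p" "p - Suc i"] assms by simp
  finally show ?thesis .
qed

text \<open>The identity between positions 0 and \<open>length us\<close>, evaluated at the letters
  of \<open>us @ vs @ ws\<close>, is the required instance of associativity.\<close>

lemma nested_satisfies_imp_associative_on:
  assumes f: "groupoid p A f"
    and sat: "\<And>i. i < p \<Longrightarrow> satisfies A f (\<epsilon>\<^sub>1 (nested p 0)) (\<epsilon>\<^sub>1 (nested p i))"
  shows "associative_on p A f"
  unfolding associative_on_def
proof (intro allI impI)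
  fix us vs ws
  assume A: "set (us @ vs @ ws) \<subseteq> A" and vs: "length vs = p"
    and len: "Suc (length us + length ws) = p"
  let ?xs = "us @ vs @ ws"
  obtain a where "a \<in> A" using f unfolding groupoid_def by blast
  \<comment> \<open>Variables are numbered from 1, so variable \<open>n\<close> takes the letter
    with index \<open>n - 1\<close>. The default \<open>a\<close> keeps the whole range of
    \<open>h\<close> inside \<open>A\<close>.\<close>
  define h where "h = (\<lambda>n. if n - 1 < length ?xs then ?xs ! (n - 1) else a)"
  have "h n \<in> A" for n
    using A \<open>a \<in> A\<close> nth_mem[of "n - 1" ?xs] unfolding h_def by (metis (no_types) subsetD)
  then have "range h \<subseteq> A" by blast
  moreover have i: "length us < p" using len by simp
  ultimately have "eval_trm f h (\<epsilon>\<^sub>1 (nested p 0)) = eval_trm f h (\<epsilon>\<^sub>1 (nested p (length us)))"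
    using sat unfolding satisfies_def by blast
  moreover have "0 < p" "length ?xs = 2 * p - 1" using len vs by auto
  ultimately show "f (us @ f vs # ws) = f (f (take p (us @ vs)) # drop p (us @ vs) @ ws)"
    using eval_nested[OF _ h_def, of 0 p f] eval_nested[OF _ h_def, of "length us" p f] i vs len
    by simp
qed

section \<open>Spectra prescribed on the bracketings with two operation symbols\<close>

text \<open>The blocks are \<open>S\<close> and its complement among the positions below
  \<open>p\<close>. Complementary sets give the same relation; requiring
  \<open>S \<subseteq> {1..<p}\<close> later selects the block without 0.\<close>

definition two_block :: "nat \<Rightarrow> nat set \<Rightarrow> (bracketing \<times> bracketing) set" where
  "two_block p S = {(s, t) \<in> Lambda p.
    \<forall>i<p. \<forall>j<p. s = nested p i \<longrightarrow> t = nested p j \<longrightarrow> (i \<in> S \<longleftrightarrow> j \<in> S)}"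

lemma nested_in_two_block:
  "i < p \<Longrightarrow> j < p \<Longrightarrow> (nested p i, nested p j) \<in> two_block p S \<longleftrightarrow> (i \<in> S \<longleftrightarrow> j \<in> S)"
  by (auto simp: two_block_def nested_in_Lambda nested_inject)

lemma two_block_neq_Lambda:
  assumes "S \<noteq> {}" "S \<subseteq> {1..<p}"
  shows "two_block p S \<noteq> Lambda p"
proof
  assume eq: "two_block p S = Lambda p"
  obtain i where i: "i \<in> S" using assms(1) by blast
  then have "i < p" "0 < p" "0 \<notin> S" using assms(2) by auto
  then show False using eq i nested_in_Lambda[of 0 p i] nested_in_two_block[of 0 p i S] by simp
qed

text \<open>A partition into two nonempty blocks cannot properly refine another. Positions outside
  \<open>S\<close> are related to 0, hence lie outside \<open>S'\<close>; positions in
  \<open>S\<close> are related to a member of \<open>S'\<close>, hence lie in \<open>S'\<close>.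
  This gives both maximality and injectivity.\<close>

lemma two_block_subset_imp_eq:
  assumes S: "S \<noteq> {}" "S \<subseteq> {1..<p}" and S': "S' \<noteq> {}" "S' \<subseteq> {1..<p}"
    and sub: "two_block p S \<subseteq> two_block p S'"
  shows "S = S'"
proof -
  have *: "(i \<in> S \<longleftrightarrow> j \<in> S) \<longrightarrow> (i \<in> S' \<longleftrightarrow> j \<in> S')" if "i < p" "j < p" for i j
    using sub nested_in_two_block[OF that, of S] nested_in_two_block[OF that, of S'] by blast
  have less: "i < p" if "i \<in> S \<union> S'" for i using that S(2) S'(2) by auto
  have 0: "0 < p" "0 \<notin> S" "0 \<notin> S'" using S S' by auto
  have sub': "S' \<subseteq> S" using *[of 0] less 0 by blast
  obtain m where m: "m \<in> S'" using S'(1) by blast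
  then have "S \<subseteq> S'" using *[of m] less sub' by blast
  then show ?thesis using sub' by blast
qed

section \<open>A groupoid realizing a two-block relation\<close>

text \<open>Here 1 is a generator, 2 is the product of generators, 3 and 4 are the values of the
  bracketings with two operation symbols, and 0 is a zero element.\<close>

definition block_op :: "nat \<Rightarrow> nat set \<Rightarrow> nat list \<Rightarrow> nat" where
  "block_op p S xs =
    (if xs = replicate p 1 then 2
     else if \<exists>i<p. i \<in> S \<and> xs = replicate i 1 @ 2 # replicate (p - Suc i) 1 then 3
     else if \<exists>i<p. xs = replicate i 1 @ 2 # replicate (p - Suc i) 1 then 4
     else 0)"

text \<open>The number of operation symbols needed to produce a nonzero value from generators
  (values above 4 are not produced at all).\<close>

definition weight :: "nat \<Rightarrow> nat" where
  "weight x = min (x - 1) 2"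

text \<open>Zero is absorbing, and along nonzero products the weights add up, plus one for the
  operation itself.\<close>

lemma block_op_nonzero:
  assumes "block_op p S xs \<noteq> 0"
  shows "0 \<notin> set xs \<and> weight (block_op p S xs) = Suc (sum_list (map weight xs))"
proof -
  have "xs = replicate p 1 \<or> (\<exists>i<p. xs = replicate i 1 @ 2 # replicate (p - Suc i) 1)"
    using assms by (auto simp: block_op_def split: if_splits)
  then show ?thesis
  proof
    assume xs: "xs = replicate p 1"
    then show ?thesis by (simp add: block_op_def weight_def sum_list_replicate)
  next
    assume "\<exists>i<p. xs = replicate i 1 @ 2 # replicate (p - Suc i) 1"
    then obtain i where i: "i < p" "xs = replicate i 1 @ 2 # replicate (p - Suc i) 1" by blast
    then have "2 \<in> set xs" by simp
    then have "xs \<noteq> replicate p 1" by (metis in_set_replicate numeral_eq_one_iff semiring_norm(85))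
    then have "block_op p S xs \<in> {3, 4}" using i by (auto simp: block_op_def)
    moreover have "sum_list (map weight xs) = 1" using i by (simp add: weight_def sum_list_replicate)
    moreover have "0 \<notin> set xs" using i by simp
    ultimately show ?thesis by (auto simp: weight_def)
  qed
qed

lemma sum_list_map_le_imp_eq:
  fixes g h :: "'b \<Rightarrow> nat"
  assumes "\<forall>x\<in>set xs. g x \<le> h x" "sum_list (map h xs) \<le> sum_list (map g xs)"
  shows "\<forall>x\<in>set xs. g x = h x"
  using assms
proof (induction xs)
  case (Cons a xs)
  moreover have "sum_list (map g xs) \<le> sum_list (map h xs)"
    using Cons.prems(1) by (intro sum_list_mono) auto
  ultimately show ?case by auto
qed simp

text \<open>Every operation symbol raises the weight by one, so the weight of a nonzero value bounds
  their number. Equality leaves weight 0 for every variable, and the only nonzero element of weight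
  0 is 1.\<close>

lemma eval_block_op_nonzero:
  assumes "eval_trm (block_op p S) h t \<noteq> 0"
  shows "omega_count t \<le> weight (eval_trm (block_op p S) h t) \<and>
    (omega_count t = weight (eval_trm (block_op p S) h t) \<longrightarrow> (\<forall>v\<in>set_trm t. h v = 1))"
  using assms
proof (induction t)
  case (Var v)
  then show ?case by (auto simp: weight_def)
next
  case (Omega ts)
  let ?e = "eval_trm (block_op p S) h"
  have nz: "\<forall>t\<in>set ts. ?e t \<noteq> 0"
    and w: "weight (?e (Omega ts)) = Suc (sum_list (map (\<lambda>t. weight (?e t)) ts))"
    using block_op_nonzero[of p S "map ?e ts"] Omega.prems by (auto simp: comp_def)
  have le: "\<forall>t\<in>set ts. omega_count t \<le> weight (?e t)"
    using Omega.IH nz by blast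
  then have "sum_list (map omega_count ts) \<le> sum_list (map (\<lambda>t. weight (?e t)) ts)"
    by (intro sum_list_mono) auto
  moreover have "\<forall>v\<in>set_trm (Omega ts). h v = 1" if "omega_count (Omega ts) = weight (?e (Omega ts))"
  proof -
    have "\<forall>t\<in>set ts. omega_count t = weight (?e t)"
      using sum_list_map_le_imp_eq[OF le] that w by simp
    then show ?thesis using Omega.IH nz by auto
  qed
  ultimately show ?case using w by simp
qed

lemma eval_trm_cong: "(\<And>v. v \<in> set_trm t \<Longrightarrow> h v = h' v) \<Longrightarrow> eval_trm f h t = eval_trm f h' t"
proof (induction t)
  case (Omega ts)
  then have "map (eval_trm f h) ts = map (eval_trm f h') ts" by (intro map_cong) auto
  then show ?case by (simp only: eval_trm.simps)
qed simp

lemma omega_count_number_vars [simp]: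
  fixes t :: "'v trm" and ts :: "'v trm list"
  shows
  "omega_count (number_vars k t) = omega_count t"
  "sum_list (map omega_count (number_vars_list k ts)) = sum_list (map omega_count ts)"
  by (induction k t and k ts rule: number_vars_number_vars_list.induct) auto

lemma set_trm_number_vars:
  fixes t :: "'v trm" and ts :: "'v trm list"
  shows
  "set_trm (number_vars k t) = {k..<k + var_count t}"
  "(\<Union>u\<in>set (number_vars_list k ts). set_trm u) = {k..<k + sum_list (map var_count ts)}"
  by (induction k t and k ts rule: number_vars_number_vars_list.induct) auto

lemma eval_number_vars_const:
  fixes t :: "'v trm" and ts :: "'v trm list"
  shows
  "eval_trm f (\<lambda>_. c) (number_vars k t) = eval_trm f (\<lambda>_. c) t"
  "map (eval_trm f (\<lambda>_. c)) (number_vars_list k ts) = map (eval_trm f (\<lambda>_. c)) ts"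
  by (induction k t and k ts rule: number_vars_number_vars_list.induct) auto

lemma eval_block_op_nested:
  assumes "i < p"
  shows "eval_trm (block_op p S) (\<lambda>_. 1) (nested p i) = (if i \<in> S then 3 else 4)"
proof -
  have "replicate i 1 @ 2 # replicate (p - Suc i) 1 \<noteq> replicate p (1::nat)"
    by (metis in_set_conv_decomp in_set_replicate numeral_eq_one_iff semiring_norm(85))
  moreover have "block_op p S (replicate p 1) = 2" by (simp add: block_op_def)
  ultimately show ?thesis
    using assms by (auto simp: nested_def block_op_def[of p S "_ @ _"] replicate_Cons_eq_iff)
qed

text \<open>Weights are at most 2, so a nonzero value needs exactly two operation symbols and the
  value 1 at every variable. Only that one evaluation has to be compared.\<close>

lemma satisfies_block_op_2:
  assumes "p > 0" "(s, t) \<in> Lambda p" "omega_count s \<ge> 2"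
    "omega_count s = 2 \<Longrightarrow>
      eval_trm (block_op p S) (\<lambda>_. 1) s = eval_trm (block_op p S) (\<lambda>_. 1) t"
  shows "satisfies UNIV (block_op p S) (\<epsilon>\<^sub>1 s) (\<epsilon>\<^sub>1 t)"
proof -
  let ?e = "eval_trm (block_op p S)"
  \<comment> \<open>Proved for a nonzero left side and then used in both directions; if both sides
    are zero, they agree anyway.\<close>
  have eq: "?e h (\<epsilon>\<^sub>1 s) = ?e h (\<epsilon>\<^sub>1 t)"
    if st: "(s, t) \<in> Lambda p" "omega_count s \<ge> 2" "omega_count s = 2 \<Longrightarrow> ?e (\<lambda>_. 1) s = ?e (\<lambda>_. 1) t"
      and nz: "?e h (\<epsilon>\<^sub>1 s) \<noteq> 0" for h s t
  proof -
    have st': "s \<in> trms p" "t \<in> trms p" "omega_count s = omega_count t"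
      using st(1) by (auto simp: Lambda_def)
    have vars: "set_trm (\<epsilon>\<^sub>1 s) = set_trm (\<epsilon>\<^sub>1 t)"
      using st' assms(1) by (simp add: \<epsilon>\<^sub>1_def set_trm_number_vars var_count_eq)
    have "weight (?e h (\<epsilon>\<^sub>1 s)) \<le> 2" by (simp add: weight_def)
    then have 2: "omega_count s = 2" and one: "\<forall>v\<in>set_trm (\<epsilon>\<^sub>1 s). h v = 1"
      using eval_block_op_nonzero[OF nz] st(2) by (auto simp: \<epsilon>\<^sub>1_def)
    have "?e h (\<epsilon>\<^sub>1 s) = ?e (\<lambda>_. 1) (\<epsilon>\<^sub>1 s)" "?e h (\<epsilon>\<^sub>1 t) = ?e (\<lambda>_. 1) (\<epsilon>\<^sub>1 t)"
      using one vars by (auto intro!: eval_trm_cong)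
    then show ?thesis using st(3)[OF 2] by (simp add: \<epsilon>\<^sub>1_def eval_number_vars_const)
  qed
  have sym: "(t, s) \<in> Lambda p" "omega_count t = omega_count s"
    using assms(2) by (auto simp: Lambda_def)
  have "?e h (\<epsilon>\<^sub>1 s) = ?e h (\<epsilon>\<^sub>1 t)" for h
    using eq[OF assms(2-4), of h] eq[OF sym(1), of h] sym(2) assms(3,4) by metis
  then show ?thesis unfolding satisfies_def by blast
qed

text \<open>Evaluating all variables at 1 separates the blocks by the values 3 and 4. Conversely,
  below two operation symbols each size has a single bracketing, and from two on
  \<open>satisfies_block_op_2\<close> applies.\<close>

lemma fine_spectrum_block_op:
  assumes "p > 0"
  shows "fine_spectrum p UNIV (block_op p S) = two_block p S"
proof (intro subset_antisym subrelI)
  fix s t assume st: "(s, t) \<in> fine_spectrum p UNIV (block_op p S)"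
  then have "eval_trm (block_op p S) (\<lambda>_. 1) (\<epsilon>\<^sub>1 s) = eval_trm (block_op p S) (\<lambda>_. 1) (\<epsilon>\<^sub>1 t)"
    by (auto simp: fine_spectrum_def satisfies_def)
  then have "eval_trm (block_op p S) (\<lambda>_. 1) s = eval_trm (block_op p S) (\<lambda>_. 1) t"
    by (simp add: \<epsilon>\<^sub>1_def eval_number_vars_const)
  then show "(s, t) \<in> two_block p S"
    using st by (auto simp: two_block_def fine_spectrum_def eval_block_op_nested
        simp del: One_nat_def split: if_splits)
next
  fix s t assume "(s, t) \<in> two_block p S"
  then have st: "(s, t) \<in> Lambda p"
    and blocks: "\<And>i j. i < p \<Longrightarrow> j < p \<Longrightarrow> s = nested p i \<Longrightarrow> t = nested p j \<Longrightarrow> i \<in> S \<longleftrightarrow> j \<in> S"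
    by (auto simp: two_block_def)
  then have st': "s \<in> trms p" "t \<in> trms p" "omega_count s = omega_count t"
    by (auto simp: Lambda_def)
  have "satisfies UNIV (block_op p S) (\<epsilon>\<^sub>1 s) (\<epsilon>\<^sub>1 t)"
  proof (cases "omega_count s \<ge> 2")
    case True
    have "eval_trm (block_op p S) (\<lambda>_. 1) s = eval_trm (block_op p S) (\<lambda>_. 1) t"
      if 2: "omega_count s = 2"
    proof -
      obtain i j where ij: "i < p" "j < p" "s = nested p i" "t = nested p j"
        using trm_omega_count_2[OF st'(1) 2] trm_omega_count_2[OF st'(2)] 2 st'(3) by metis
      then show ?thesis using blocks[OF ij] by (simp add: eval_block_op_nested del: One_nat_def)
    qed
    then show ?thesis using satisfies_block_op_2[OF assms st True] by blast
  next
    case False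
    then consider "omega_count s = 0" | "omega_count s = 1" by linarith
    then have "s = t"
    proof cases
      case 1
      then show ?thesis using trm_omega_count_0[of s] trm_omega_count_0[of t] st' by simp
    next
      case 2
      then show ?thesis using trm_omega_count_1[of s p] trm_omega_count_1[of t p] st' by simp
    qed
    then show ?thesis by (simp add: satisfies_def)
  qed
  then show "(s, t) \<in> fine_spectrum p UNIV (block_op p S)"
    using st by (simp add: fine_spectrum_def)
qed

section \<open>The coatoms\<close>

lemma fine_spectrum_subset_two_block:
  assumes p: "p \<ge> 2" and f: "groupoid p A f" and neq: "fine_spectrum p A f \<noteq> Lambda p"
  obtains S where "S \<noteq> {}" "S \<subseteq> {1..<p}" "fine_spectrum p A f \<subseteq> two_block p S"
proof
  \<comment> \<open>The complement of the class of position 0; all other classes are merged into one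
    block.\<close>
  define S where "S = {i. i < p \<and> \<not> satisfies A f (\<epsilon>\<^sub>1 (nested p 0)) (\<epsilon>\<^sub>1 (nested p i))}"
  show "S \<noteq> {}"
  proof
    assume "S = {}"
    then have "associative_on p A f"
      using f by (intro nested_satisfies_imp_associative_on) (auto simp: S_def)
    then show False
      using neq associative_on_imp_satisfies[OF p f] by (auto simp: fine_spectrum_def)
  qed
  have "0 \<notin> S" by (simp add: S_def satisfies_def)
  then show "S \<subseteq> {1..<p}" by (auto simp: S_def Suc_le_eq intro: gr0I)
  \<comment> \<open>By transitivity, two identified positions are either both identified with 0 or
    both not.\<close>
  show "fine_spectrum p A f \<subseteq> two_block p S"
    unfolding fine_spectrum_def two_block_def S_def satisfies_def by clarsimp metis
qed

lemma two_block_in_fine_spectra: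
  assumes "p > 0" "infinite (UNIV :: 'a set)"
  shows "two_block p S \<in> fine_spectra p TYPE('a)"
  using fine_spectrum_in_fine_spectra[OF assms(2), of p UNIV "block_op p S"]
    fine_spectrum_block_op[OF assms(1)]
  by (simp add: groupoid_def)

lemma coatoms_fine_spectra:
  assumes p: "p \<ge> 2" and inf: "infinite (UNIV :: 'a set)"
  shows "coatoms (fine_spectra p TYPE('a)) = two_block p ` {S. S \<noteq> {} \<and> S \<subseteq> {1..<p}}"
proof -
  let ?P = "fine_spectra p TYPE('a)"
  have tb: "two_block p S \<in> ?P" for S using two_block_in_fine_spectra[OF _ inf] p by simp
  \<comment> \<open>The empty block imposes no condition, so the same construction also realizes the
    greatest element.\<close>
  have "two_block p {} = Lambda p" by (simp add: two_block_def)
  then have top: "Lambda p \<in> ?P" using tb by metis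
  have le: "x \<subseteq> Lambda p" if "x \<in> ?P" for x
    using that by (auto simp: fine_spectra_def fine_spectrum_def)
  have below: "\<exists>S. S \<noteq> {} \<and> S \<subseteq> {1..<p} \<and> x \<subseteq> two_block p S"
    if x: "x \<in> ?P" "x \<subset> Lambda p" for x
  proof -
    obtain A and f :: "'a list \<Rightarrow> 'a" where f: "groupoid p A f" and eq: "x = fine_spectrum p A f"
      using x(1) unfolding fine_spectra_def by auto
    then have "fine_spectrum p A f \<noteq> Lambda p" using x(2) by simp
    then obtain S where "S \<noteq> {}" "S \<subseteq> {1..<p}" "fine_spectrum p A f \<subseteq> two_block p S"
      by (rule fine_spectrum_subset_two_block[OF p f])
    then show ?thesis unfolding eq by (intro exI[of _ S]) simp
  qed
  have proper: "two_block p S \<subset> Lambda p" if "S \<noteq> {}" "S \<subseteq> {1..<p}" for S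
    using two_block_neq_Lambda[OF that] le[OF tb] by blast
  have coatom: "x \<in> coatoms ?P \<longleftrightarrow> x \<in> ?P \<and> x \<subset> Lambda p \<and> (\<nexists>z. z \<in> ?P \<and> x \<subset> z \<and> z \<subset> Lambda p)"
    for x
  proof -
    have "g \<in> ?P \<and> (\<forall>y\<in>?P. y \<subseteq> g) \<longleftrightarrow> g = Lambda p" for g using top le by blast
    then have "x \<in> coatoms ?P \<longleftrightarrow> covered_in ?P x (Lambda p)"
      unfolding coatoms_def mem_Collect_eq Bex_def by metis
    then show ?thesis using top by (simp add: covered_in_def)
  qed
  show ?thesis
  proof (rule subset_antisym; rule subsetI)
    fix x assume "x \<in> coatoms ?P"
    from iffD1[OF coatom this] have x: "x \<in> ?P" "x \<subset> Lambda p" "\<nexists>z. z \<in> ?P \<and> x \<subset> z \<and> z \<subset> Lambda p"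
      by simp_all
    then obtain S where S: "S \<noteq> {}" "S \<subseteq> {1..<p}" "x \<subseteq> two_block p S"
      using below[OF x(1,2)] by blast
    have "x = two_block p S"
    proof (rule ccontr)
      assume "x \<noteq> two_block p S"
      then have "two_block p S \<in> ?P \<and> x \<subset> two_block p S \<and> two_block p S \<subset> Lambda p"
        using S(3) tb[of S] proper[OF S(1,2)] by simp
      then show False by (rule notE[OF x(3) exI])
    qed
    then show "x \<in> two_block p ` {S. S \<noteq> {} \<and> S \<subseteq> {1..<p}}"
      using S(1,2) by (intro image_eqI[of _ _ S]) simp_all
  next
    fix x assume "x \<in> two_block p ` {S. S \<noteq> {} \<and> S \<subseteq> {1..<p}}"
    then obtain S where x: "x = two_block p S" and "S \<in> {S. S \<noteq> {} \<and> S \<subseteq> {1..<p}}"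
      by (rule imageE)
    then have S: "S \<noteq> {}" "S \<subseteq> {1..<p}" by simp_all
    have False if z: "z \<in> ?P" "two_block p S \<subset> z" "z \<subset> Lambda p" for z
    proof -
      obtain S' where S': "S' \<noteq> {}" "S' \<subseteq> {1..<p}" "z \<subseteq> two_block p S'"
        using below[OF z(1,3)] by blast
      \<comment> \<open>A spectrum strictly between would place one two-block relation below
        another, forcing equality.\<close>
      then have "two_block p S \<subseteq> two_block p S'" using z(2) by order
      then have "S = S'" by (rule two_block_subset_imp_eq[OF S S'(1,2)])
      then show False using S'(3) z(2) by simp
    qed
    then show "x \<in> coatoms ?P"
      unfolding x using tb[of S] proper[OF S] by (intro iffD2[OF coatom] conjI notI) auto
  qed
qed

theorem corollary6p3:
  fixes p :: nat
  assumes "p \<ge> 2" and "infinite (UNIV :: 'a set)"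
  shows "card (coatoms (fine_spectra p TYPE('a))) = 2 ^ (p - 1) - 1"
proof -
  have "inj_on (two_block p) {S. S \<noteq> {} \<and> S \<subseteq> {1..<p}}"
    by (intro inj_onI, clarify) (rule two_block_subset_imp_eq[OF _ _ _ _ equalityD1])
  then have "card (coatoms (fine_spectra p TYPE('a))) = card {S. S \<noteq> {} \<and> S \<subseteq> {1..<p}}"
    by (simp add: coatoms_fine_spectra[OF assms] card_image)
  also have "{S. S \<noteq> {} \<and> S \<subseteq> {1..<p}} = Pow {1..<p} - {{}}" by blast
  also have "card \<dots> = 2 ^ (p - 1) - 1" by (simp add: card_Pow)
  finally show ?thesis .
qed

end
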